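(* For every odd integer $t\ge 17$, $$2t-1\le \operatorname{DS}(3,t)\le 5t-10.$$
   Context: Graphs are finite and simple. A graph is $R(s,t)$-good if it contains neither a clique of order $s$ nor an independent set of order $t$. It is doubly saturated $R(s,t)$-good if it is $R(s,t)$-good, adding any missing edge destroys that property, and deleting any existing edge also destroys that property. $\operatorname{DS}(s,t)$ denotes the minimum order (number of vertices) of a doubly saturated $R(s,t)$-good graph, when one exists.
   Formalization: DS(3,t) is taken as the minimum order over doubly saturated graphs with at least two vertices; read literally, the empty graph and the one-vertex graph satisfy both saturation conditions vacuously, which would make the lower bound false. *)

theory Defs
  imports "HOL-Library.Ramsey" "HOL-Library.Extended_Nat"
begin

text \<open>A graph is a vertex set \<open>V\<close> with an edge set \<open>E\<close> of two-element subsets of \<open>V\<close>;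
  cliques and independent sets are those of \<open>HOL-Library.Ramsey\<close>.\<close>

definition finite_simple_graph :: "'a set \<Rightarrow> 'a set set \<Rightarrow> bool" where
  "finite_simple_graph V E \<longleftrightarrow> finite V \<and> E \<subseteq> [V]\<^bsup>2\<^esup>"

definition R_good :: "nat \<Rightarrow> nat \<Rightarrow> 'a set \<Rightarrow> 'a set set \<Rightarrow> bool" where
  "R_good s t V E \<longleftrightarrow>
     \<not> (\<exists>K\<subseteq>V. card K = s \<and> clique K E) \<and>
     \<not> (\<exists>I\<subseteq>V. card I = t \<and> indep I E)"

definition doubly_saturated :: "nat \<Rightarrow> nat \<Rightarrow> 'a set \<Rightarrow> 'a set set \<Rightarrow> bool" where
  "doubly_saturated s t V E \<longleftrightarrow>
     R_good s t V E \<and>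
     (\<forall>e \<in> [V]\<^bsup>2\<^esup> - E. \<not> R_good s t V (insert e E)) \<and>
     (\<forall>e \<in> E. \<not> R_good s t V (E - {e}))"

text \<open>A graph of order 0 or 1 has no pair of vertices, so both saturation conditions hold
  vacuously and it would be doubly saturated whenever \<open>s, t \<ge> 2\<close>. These degenerate graphs are
  excluded from the minimum; from order 2 on there is always an edge or a missing edge to test.
  Every finite graph has an isomorphic copy on a set of natural numbers, so quantifying over
  such vertex sets loses nothing. If no graph qualifies, the value is \<open>\<infinity>\<close>; a finite upper
  bound on \<open>DS s t\<close> therefore includes the existence of a doubly saturated graph.\<close>

definition DS :: "nat \<Rightarrow> nat \<Rightarrow> enat" where
  "DS s t = Inf {enat (card V) | (V :: nat set) E.
     finite_simple_graph V E \<and> 2 \<le> card V \<and> doubly_saturated s t V E}"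

end

theory Submission
  imports Defs
begin

text \<open>A doubly saturated graph is triangle-free of diameter two and \<open>\<alpha>\<close>-critical with independence
  number \<open>t - 1\<close>. In an \<open>\<alpha>\<close>-critical graph without isolated vertices, an independent set \<open>S\<close> has at
  least \<open>card S\<close> neighbours (Hajnal), and equality forces a vertex of degree one; diameter two then
  makes the graph a star. Applied to a maximum independent set, this is the lower bound.

  For the upper bound, take five copies of a tournament on \<open>m = t - 2\<close> vertices, indexed cyclically;
  join \<open>(i, a)\<close> to \<open>(i + 1, b)\<close> when \<open>a\<close> beats \<open>b\<close>, and to \<open>(i + 2, a)\<close>. This graph is always
  triangle-free, and deleting any edge leaves an independent set of size \<open>m + 2\<close>. It remains to find a
  tournament for which the diameter is two and the independence number is at most \<open>m + 1\<close>. Both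
  properties survive the substitution of one tournament for a vertex of another, so tournaments on 7
  and 9 vertices yield all odd \<open>m \<ge> 13\<close>.\<close>

subsection \<open>The lower bound\<close>

lemma simple_graph_edgeD:
  assumes "finite_simple_graph V E" "{x, y} \<in> E"
  shows "x \<in> V" "y \<in> V" "x \<noteq> y"
proof -
  have "{x, y} \<subseteq> V" "card {x, y} = 2"
    using assms unfolding finite_simple_graph_def nsets_def by auto
  then show "x \<in> V" "y \<in> V" "x \<noteq> y" by auto
qed

section \<open>Hajnal's inequality and its equality case in \<alpha>-critical graphs\<close>

locale alpha_critical =
  fixes V :: "'a set" and E :: "'a set set" and t :: nat
  assumes graph: "finite_simple_graph V E"
    and indep_less: "I \<subseteq> V \<Longrightarrow> indep I E \<Longrightarrow> card I < t"
    and critical: "{x, y} \<in> E \<Longrightarrow> \<exists>K\<subseteq>V. card K = t \<and> x \<in> K \<and> y \<in> K \<and> indep K (E - {{x, y}})"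
    and no_isolated: "x \<in> V \<Longrightarrow> \<exists>y. {x, y} \<in> E"
begin

lemma finite_V: "finite V"
  using graph by (simp add: finite_simple_graph_def)

lemmas edgeD = simple_graph_edgeD[OF graph]

definition nbrs :: "'a set \<Rightarrow> 'a set" where
  "nbrs S = {v \<in> V. \<exists>s\<in>S. {s, v} \<in> E}"

lemma finite_nbrs: "finite (nbrs S)"
  using finite_V by (simp add: nbrs_def)

lemma nbrs_disjoint_indep: "indep J E \<Longrightarrow> S \<subseteq> J \<Longrightarrow> nbrs S \<inter> J = {}"
  unfolding nbrs_def indep_def using edgeD(3) by blast

text \<open>Dropping \<open>x\<close> from the \<open>t\<close>-set that becomes independent when
  \<open>{x, y}\<close> is deleted leaves a maximum independent set in which \<open>y\<close> is the
  only possible neighbour of \<open>x\<close>.\<close>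

lemma critical_indep:
  assumes "{x, y} \<in> E"
  obtains J where "J \<subseteq> V" "indep J E" "Suc (card J) = t" "x \<notin> J"
    "\<And>z. z \<in> J \<Longrightarrow> {x, z} \<in> E \<Longrightarrow> z = y"
proof -
  obtain K where K: "K \<subseteq> V" "card K = t" "x \<in> K" "y \<in> K" "indep K (E - {{x, y}})"
    using critical[OF assms] by blast
  have fin: "finite K" using K(1) finite_V finite_subset by blast
  show thesis
  proof
    show "K - {x} \<subseteq> V" using K by blast
    show "indep (K - {x}) E" using K(5) unfolding indep_def by (auto simp: doubleton_eq_iff)
    show "Suc (card (K - {x})) = t" using K(2,3) fin by (metis card_Suc_Diff1)
    show "x \<notin> K - {x}" by simp
    show "z = y" if "z \<in> K - {x}" "{x, z} \<in> E" for z
      using that K(3,5) unfolding indep_def by (auto simp: doubleton_eq_iff)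
  qed
qed

text \<open>Replace the neighbours of \<open>S\<close> in \<open>J\<close> by \<open>S\<close>: the result is independent, hence not larger
  than \<open>J\<close>.\<close>

lemma card_exchange:
  assumes S: "S \<subseteq> V" "indep S E" and J: "J \<subseteq> V" "indep J E" "Suc (card J) = t"
  shows "card (S - J) \<le> card (J \<inter> nbrs S)"
proof -
  let ?J = "(J - nbrs S) \<union> S"
  have fin: "finite J" "finite S" using S J finite_V finite_subset by blast+
  have "{v, w} \<notin> E" if "v \<in> S" "w \<in> J - nbrs S" for v w
    using that J(1) by (auto simp: nbrs_def)
  then have "indep ?J E"
    using S(2) J(2) unfolding indep_def by (metis DiffD1 UnE insert_commute)
  then have "card ?J < t" using S(1) J(1) by (intro indep_less) auto
  \<comment> \<open>\<open>S\<close> misses its own neighbourhood, so \<open>S \<inter> J\<close>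
    survives the exchange and only \<open>S - J\<close> is added.\<close>
  moreover have "S \<inter> nbrs S = {}" using nbrs_disjoint_indep[OF S(2)] by blast
  then have "?J = (J - nbrs S) \<union> (S - J)" "(J - nbrs S) \<inter> (S - J) = {}" by blast+
  then have "card ?J = card (J - nbrs S) + card (S - J)"
    using fin by (metis card_Un_disjoint finite_Diff)
  moreover have "card J = card (J - nbrs S) + card (J \<inter> nbrs S)"
    using fin by (metis card_Diff_subset_Int card_mono finite_Int inf_le1 le_add_diff_inverse2)
  ultimately show ?thesis using J(3) by linarith
qed

text \<open>Neighbours of \<open>S \<inter> J\<close> lie outside \<open>J\<close>, while the
  exchange bounds those of \<open>S\<close> inside \<open>J\<close>. Together the three facts say
  that the surplus \<open>card (nbrs S) - card S\<close>, as an integer, is at least the surplus of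
  \<open>S \<inter> J\<close>.\<close>

lemma card_nbrs_split:
  assumes S: "S \<subseteq> V" "indep S E" and J: "J \<subseteq> V" "indep J E" "Suc (card J) = t"
  shows "card (S - J) + card (nbrs (S \<inter> J)) \<le> card (J \<inter> nbrs S) + card (nbrs S - J)"
    and "card (nbrs S) = card (J \<inter> nbrs S) + card (nbrs S - J)"
    and "card S = card (S - J) + card (S \<inter> J)"
proof -
  have "nbrs (S \<inter> J) \<subseteq> nbrs S - J"
    using nbrs_disjoint_indep[OF J(2), of "S \<inter> J"] by (auto simp: nbrs_def)
  then have "card (nbrs (S \<inter> J)) \<le> card (nbrs S - J)"
    using finite_nbrs by (intro card_mono) auto
  then show "card (S - J) + card (nbrs (S \<inter> J)) \<le> card (J \<inter> nbrs S) + card (nbrs S - J)"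
    using card_exchange[OF assms] by simp
  show "card (nbrs S) = card (J \<inter> nbrs S) + card (nbrs S - J)"
    using finite_nbrs[of S] by (metis card_Int_Diff inf_commute)
  show "card S = card (S - J) + card (S \<inter> J)"
    using S finite_V by (metis add.commute card_Int_Diff finite_subset)
qed

lemma indep_subset: "indep J E \<Longrightarrow> S \<subseteq> J \<Longrightarrow> indep S E"
  unfolding indep_def by blast

text \<open>Choosing \<open>J\<close> to avoid some \<open>x\<close> in \<open>S\<close> makes
  \<open>S \<inter> J\<close> a proper subset; its surplus is nonnegative by induction, and that of
  \<open>S\<close> is no smaller.\<close>

lemma card_le_card_nbrs:
  assumes "S \<subseteq> V" "indep S E"
  shows "card S \<le> card (nbrs S)"
proof -
  have "finite S" using assms(1) finite_V finite_subset by blast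
  then show ?thesis using assms
  proof (induction rule: finite_psubset_induct)
    case (psubset S)
    show ?case
    proof (cases "S = {}")
      case False
      then obtain x where x: "x \<in> S" by blast
      then obtain y where "{x, y} \<in> E" using no_isolated psubset.prems by blast
      then obtain J where J: "J \<subseteq> V" "indep J E" "Suc (card J) = t" "x \<notin> J"
        using critical_indep by metis
      have "card (S \<inter> J) \<le> card (nbrs (S \<inter> J))"
        using psubset.prems x J(4) indep_subset[OF J(2)] by (intro psubset.IH) auto
      then show ?thesis
        using card_nbrs_split[OF psubset.prems J(1-3)] by linarith
    qed simp
  qed
qed

text \<open>If \<open>S\<close> has surplus 0, so does \<open>S \<inter> J\<close>; the descent
  through nonempty tight sets ends where \<open>S \<inter> J\<close> is empty, and there
  \<open>x\<close> is a leaf.\<close>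

lemma tight_imp_leaf:
  assumes "S \<subseteq> V" "indep S E" "S \<noteq> {}" "card (nbrs S) \<le> card S"
  shows "\<exists>x\<in>V. \<exists>y. nbrs {x} = {y}"
proof -
  have "finite S" using assms(1) finite_V finite_subset by blast
  then show ?thesis using assms
  proof (induction rule: finite_psubset_induct)
    case (psubset S)
    note S = \<open>S \<subseteq> V\<close> \<open>indep S E\<close>
    obtain x where x: "x \<in> S" using psubset.prems by blast
    then obtain y where xy: "{x, y} \<in> E" using no_isolated psubset.prems by blast
    then obtain J where J: "J \<subseteq> V" "indep J E" "Suc (card J) = t" "x \<notin> J"
      and Jx: "\<And>z. z \<in> J \<Longrightarrow> {x, z} \<in> E \<Longrightarrow> z = y"
      using critical_indep by metis
    have SJ: "S \<inter> J \<subseteq> V" "indep (S \<inter> J) E" using S indep_subset by blast+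
    note split = card_nbrs_split[OF S J(1-3)]
    show ?case
    proof (cases "S \<inter> J = {}")
      \<comment> \<open>The exchange now replaces all of \<open>S\<close>, so tightness forces every
        neighbour of \<open>S\<close> into \<open>J\<close>, where \<open>x\<close> has no neighbour
        but \<open>y\<close>.\<close>
      case True
      then have "card (nbrs S) \<le> card (J \<inter> nbrs S)"
        using card_exchange[OF S J(1-3)] split(3) psubset.prems(4) by simp
      then have "J \<inter> nbrs S = nbrs S"
        using finite_nbrs by (metis card_seteq inf_le2)
      then have "nbrs {x} = {y}"
        using Jx x xy edgeD(2)[OF xy] unfolding nbrs_def by blast
      then show ?thesis using x S by blast
    next
      case False
      have "card (S \<inter> J) \<le> card (nbrs (S \<inter> J))"
        by (rule card_le_card_nbrs[OF SJ])
      then have "card (nbrs (S \<inter> J)) \<le> card (S \<inter> J)"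
        using split psubset.prems(4) by linarith
      then show ?thesis
        using x J(4) SJ False by (intro psubset.IH) auto
    qed
  qed
qed

text \<open>With at most \<open>2 * (t - 1)\<close> vertices, a maximum independent set is tight, so
  there is a leaf \<open>x\<close> with neighbour \<open>y\<close>. Any common neighbour of
  \<open>x\<close> and another vertex is \<open>y\<close>, so all vertices hang on \<open>y\<close>,
  and by triangle-freeness the rest is independent and too large.\<close>

lemma card_ge:
  assumes "V \<noteq> {}" "2 < t"
    and no_triangle: "\<And>x y z. {x, y} \<in> E \<Longrightarrow> {y, z} \<in> E \<Longrightarrow> {x, z} \<notin> E"
    and diameter: "\<And>x y. x \<in> V \<Longrightarrow> y \<in> V \<Longrightarrow> x \<noteq> y \<Longrightarrow> {x, y} \<notin> E \<Longrightarrow>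
      \<exists>z. {x, z} \<in> E \<and> {y, z} \<in> E"
  shows "2 * t - 1 \<le> card V"
proof (rule ccontr)
  assume "\<not> ?thesis"
  then have small: "card V \<le> 2 * (t - 1)" by linarith
  obtain x y where "{x, y} \<in> E" using assms(1) no_isolated by blast
  then obtain J where J: "J \<subseteq> V" "indep J E" "Suc (card J) = t"
    using critical_indep by metis
  have "nbrs J \<subseteq> V - J" using nbrs_disjoint_indep[OF J(2) order_refl] by (auto simp: nbrs_def)
  then have "card (nbrs J) \<le> card V - card J"
    using J(1) finite_V by (metis card_Diff_subset card_mono finite_Diff finite_subset)
  moreover from this have "2 * (t - 1) \<le> card V"
    using card_le_card_nbrs[OF J(1,2)] J(1,3) card_mono[OF finite_V J(1)] by linarith
  ultimately have "card (nbrs J) \<le> card J" "card V = 2 * (t - 1)" using small J(3) by linarith+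
  moreover have "J \<noteq> {}" using J(3) assms(2) by auto
  ultimately obtain x y where x: "x \<in> V" and y: "nbrs {x} = {y}"
    using tight_imp_leaf[OF J(1,2)] by blast
  have x_nbr: "z = y" if "{x, z} \<in> E" for z
    using y that edgeD(2)[OF that] unfolding nbrs_def by blast
  have "{z, y} \<in> E" if "z \<in> V" "z \<noteq> x" "z \<noteq> y" for z
    using diameter[of x z] x that x_nbr by metis
  note y_nbr = this
  have "indep (V - {y}) E"
    unfolding indep_def
  proof (intro ballI impI notI)
    fix u v assume uv: "u \<in> V - {y}" "v \<in> V - {y}" "{u, v} \<in> E"
    then have "u \<noteq> x" "v \<noteq> x" using x_nbr[of v] x_nbr[of u] by (auto simp: insert_commute)
    then have "{u, y} \<in> E" "{v, y} \<in> E" using y_nbr uv by auto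
    then show False using no_triangle[of u v y] uv(3) by blast
  qed
  then have "card (V - {y}) < t" using indep_less by blast
  moreover have "card V - 1 \<le> card (V - {y})" by (simp add: card_Diff_singleton_if)
  \<comment> \<open>Here \<open>2 * t - 3 < t\<close>, impossible for \<open>2 < t\<close>.\<close>
  ultimately show False using \<open>card V = 2 * (t - 1)\<close> assms(2) by linarith
qed

end

section \<open>From double saturation to \<alpha>-criticality and diameter two\<close>

lemma R_good_3I:
  assumes "\<And>x y z. {x, y} \<in> E \<Longrightarrow> {y, z} \<in> E \<Longrightarrow> {x, z} \<in> E \<Longrightarrow> x \<noteq> y \<Longrightarrow> y \<noteq> z \<Longrightarrow> x \<noteq> z \<Longrightarrow> False"
    and "\<And>I. I \<subseteq> V \<Longrightarrow> indep I E \<Longrightarrow> card I \<noteq> t"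
  shows "R_good 3 t V E"
  unfolding R_good_def
proof (intro conjI notI)
  assume "\<exists>K\<subseteq>V. card K = 3 \<and> clique K E"
  then obtain x y z where "x \<noteq> y" "y \<noteq> z" "x \<noteq> z" "clique {x, y, z} E"
    by (auto simp: card_3_iff)
  then show False using assms(1)[of x y z] by (simp add: clique_def)
next
  assume "\<exists>I\<subseteq>V. card I = t \<and> indep I E"
  then show False using assms(2) by blast
qed

text \<open>Adding an edge can only create a triangle, deleting one only an independent set; so the
  two saturation conditions become diameter two and edge-criticality.\<close>

lemma doubly_saturated_lower_bound:
  assumes graph: "finite_simple_graph V E" and "2 \<le> card V"
    and ds: "doubly_saturated 3 t V E" and t: "2 < t"
  shows "2 * t - 1 \<le> card V"
proof -
  have good: "R_good 3 t V E" using ds by (simp add: doubly_saturated_def)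
  have fin: "finite V" using graph by (simp add: finite_simple_graph_def)
  note edgeD = simple_graph_edgeD[OF graph]
  have no_triangle: "{x, z} \<notin> E" if "{x, y} \<in> E" "{y, z} \<in> E" for x y z
  proof
    assume xz: "{x, z} \<in> E"
    have "{x, y, z} \<subseteq> V" "card {x, y, z} = 3" "clique {x, y, z} E"
      using that xz edgeD[OF that(1)] edgeD[OF that(2)] edgeD[OF xz]
      unfolding clique_def by (auto simp: insert_commute)
    then show False using good unfolding R_good_def by blast
  qed
  have diameter: "\<exists>z. {x, z} \<in> E \<and> {y, z} \<in> E"
    if "x \<in> V" "y \<in> V" "x \<noteq> y" "{x, y} \<notin> E" for x y
  proof -
    have "{x, y} \<in> [V]\<^bsup>2\<^esup> - E" using that by (auto simp: nsets_def)
    then have "\<not> R_good 3 t V (insert {x, y} E)" using ds by (simp add: doubly_saturated_def)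
    moreover have "indep I E" if "indep I (insert {x, y} E)" for I
      using that unfolding indep_def by blast
    ultimately obtain K where K: "K \<subseteq> V" "card K = 3" "clique K (insert {x, y} E)"
      using good unfolding R_good_def by blast
    have "\<not> clique K E" using K good unfolding R_good_def by blast
    then obtain u v where "u \<in> K" "v \<in> K" "u \<noteq> v" "{u, v} = {x, y}"
      using K(3) unfolding clique_def by (metis insertE)
    then have xy: "x \<in> K" "y \<in> K" by (auto simp: doubleton_eq_iff)
    have "\<not> K \<subseteq> {x, y}" using K(2) card_mono[of "{x, y}" K] that(3) by auto
    then obtain z where z: "z \<in> K" "z \<noteq> x" "z \<noteq> y" by blast
    then have "{x, z} \<in> insert {x, y} E" "{y, z} \<in> insert {x, y} E"
      using K(3) xy unfolding clique_def by metis+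
    then show ?thesis using z by (auto simp: doubleton_eq_iff)
  qed
  interpret alpha_critical V E t
  proof
    show "finite_simple_graph V E" by (rule graph)
  next
    fix I assume I: "I \<subseteq> V" "indep I E"
    show "card I < t"
    proof (rule ccontr)
      assume "\<not> card I < t"
      then obtain J where "J \<subseteq> I" "card J = t" by (meson not_less obtain_subset_with_card_n)
      moreover from this have "indep J E" using I(2) unfolding indep_def by blast
      ultimately show False using I(1) good unfolding R_good_def by blast
    qed
  next
    fix x y assume xy: "{x, y} \<in> E"
    then have "\<not> R_good 3 t V (E - {{x, y}})" using ds by (simp add: doubly_saturated_def)
    moreover have "clique K E" if "clique K (E - {{x, y}})" for K
      using that unfolding clique_def by blast
    ultimately obtain K where K: "K \<subseteq> V" "card K = t" "indep K (E - {{x, y}})"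
      using good unfolding R_good_def by blast
    have "\<not> indep K E" using K good unfolding R_good_def by blast
    then obtain u v where "u \<in> K" "v \<in> K" "{u, v} = {x, y}"
      using K(3) unfolding indep_def by blast
    then have "x \<in> K" "y \<in> K" by (auto simp: doubleton_eq_iff)
    then show "\<exists>K\<subseteq>V. card K = t \<and> x \<in> K \<and> y \<in> K \<and> indep K (E - {{x, y}})"
      using K by blast
  next
    fix x assume x: "x \<in> V"
    \<comment> \<open>A second vertex is either adjacent to \<open>x\<close> or shares a neighbour
      with it.\<close>
    have "\<not> V \<subseteq> {x}" using \<open>2 \<le> card V\<close> card_mono[of "{x}" V] by auto
    then obtain y where "y \<in> V" "y \<noteq> x" by blast
    then show "\<exists>y. {x, y} \<in> E" using diameter x by blast
  qed
  show ?thesis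
    using \<open>2 \<le> card V\<close> t no_triangle diameter by (intro card_ge) auto
qed

subsection \<open>Layered graphs of tournaments\<close>

datatype layer = Z0 | Z1 | Z2 | Z3 | Z4

fun nxt :: "layer \<Rightarrow> layer" where
  "nxt Z0 = Z1" | "nxt Z1 = Z2" | "nxt Z2 = Z3" | "nxt Z3 = Z4" | "nxt Z4 = Z0"

lemma UNIV_layer: "UNIV = {Z0, Z1, Z2, Z3, Z4}"
  using layer.exhaust by auto

instance layer :: finite
  by standard (simp add: UNIV_layer)

lemma card_layer: "card (UNIV :: layer set) = 5"
  by (simp add: UNIV_layer)

text \<open>A layering encodes an independent set of the five-layer graph: \<open>L a\<close> is the set of layers \<open>i\<close>
  for which it contains \<open>(i, a)\<close>.\<close>

definition layering :: "nat \<Rightarrow> (nat \<Rightarrow> nat \<Rightarrow> bool) \<Rightarrow> (nat \<Rightarrow> layer set) \<Rightarrow> bool" where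
  "layering m r L \<longleftrightarrow>
     (\<forall>a<m. \<forall>i\<in>L a. nxt (nxt i) \<notin> L a) \<and>
     (\<forall>a<m. \<forall>b<m. r a b \<longrightarrow> (\<forall>i\<in>L a. nxt i \<notin> L b))"

text \<open>The third and fourth conditions give diameter two, the last one independence number at most
  \<open>m + 1\<close>.\<close>

definition good_tournament :: "nat \<Rightarrow> (nat \<Rightarrow> nat \<Rightarrow> bool) \<Rightarrow> bool" where
  "good_tournament m r \<longleftrightarrow>
     (\<forall>a<m. \<not> r a a) \<and>
     (\<forall>a<m. \<forall>b<m. a \<noteq> b \<longrightarrow> r a b = (\<not> r b a)) \<and>
     (\<forall>a<m. \<forall>b<m. a \<noteq> b \<longrightarrow> (\<exists>c<m. r a c \<and> r b c \<or> r c a \<and> r c b)) \<and>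
     (\<forall>a<m. \<forall>b<m. r a b \<longrightarrow> (\<exists>c<m. r a c \<and> r c b)) \<and>
     (\<forall>L. layering m r L \<longrightarrow> (\<Sum>a<m. card (L a)) \<le> m + 1)"

lemma nxt_neq: "nxt i \<noteq> i" "i \<noteq> nxt i" "nxt (nxt i) \<noteq> i" "i \<noteq> nxt (nxt i)"
  by (cases i; simp)+

text \<open>Joining layers two apart gives another 5-cycle, and \<open>A\<close> is independent in
  it: at most two layers, and if two, then consecutive ones.\<close>

lemma layer_set_cases:
  assumes "\<And>i. i \<in> A \<Longrightarrow> nxt (nxt i) \<notin> A"
  obtains "A = {}" | i where "A = {i}" | i where "A = {i, nxt i}"
proof (cases "A = {}")
  case False
  then obtain i where i: "i \<in> A" by blast
  have A: "j \<in> {i, nxt i, nxt (nxt i), nxt (nxt (nxt i)), nxt (nxt (nxt (nxt i)))}" for j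
    by (cases i; cases j; simp)
  have no: "nxt (nxt i) \<notin> A" "nxt (nxt (nxt i)) \<notin> A"
    "nxt i \<in> A \<Longrightarrow> nxt (nxt (nxt (nxt i))) \<notin> A"
    using assms[OF i] assms[of "nxt (nxt (nxt i))"] assms[of "nxt (nxt (nxt (nxt i)))"] i
    by (cases i; force)+
  \<comment> \<open>The predecessor of \<open>i\<close>, four steps ahead on a cycle of length
    five.\<close>
  let ?k = "nxt (nxt (nxt (nxt i)))"
  have "nxt ?k = i" by (cases i) auto
  moreover have "A \<subseteq> {i, nxt i, ?k}"
  proof
    fix j assume "j \<in> A"
    then show "j \<in> {i, nxt i, ?k}" using A[of j] no(1,2) by (elim insertE) auto
  qed
  ultimately have "A = {i, nxt i} \<or> A = {?k, nxt ?k} \<or> A = {i}"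
    using i no(3) by (cases "nxt i \<in> A"; cases "?k \<in> A") auto
  then show thesis using that(2)[of i] that(3)[of i] that(3)[of ?k] by argo
qed (rule that(1))

section \<open>The five-layer graph of a tournament\<close>

definition linked :: "(nat \<Rightarrow> nat \<Rightarrow> bool) \<Rightarrow> layer \<times> nat \<Rightarrow> layer \<times> nat \<Rightarrow> bool" where
  "linked r = (\<lambda>(i, a) (j, b).
     j = nxt i \<and> r a b \<or> i = nxt j \<and> r b a \<or> a = b \<and> (j = nxt (nxt i) \<or> i = nxt (nxt j)))"

definition layered_vertices :: "nat \<Rightarrow> (layer \<times> nat) set" where
  "layered_vertices m = UNIV \<times> {..<m}"

definition layered_edges :: "nat \<Rightarrow> (nat \<Rightarrow> nat \<Rightarrow> bool) \<Rightarrow> (layer \<times> nat) set set" where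
  "layered_edges m r = {{x, y} | x y. x \<in> layered_vertices m \<and> y \<in> layered_vertices m \<and> linked r x y}"

lemma linked_sym: "linked r x y \<longleftrightarrow> linked r y x"
  by (auto simp: linked_def split: prod.splits)

lemma linked_irrefl: "\<not> linked r x x"
  by (auto simp: linked_def nxt_neq split: prod.splits)

lemma edge_iff:
  "{x, y} \<in> layered_edges m r \<longleftrightarrow>
     x \<in> layered_vertices m \<and> y \<in> layered_vertices m \<and> linked r x y"
  unfolding layered_edges_def mem_Collect_eq doubleton_eq_iff using linked_sym[of r x y] by blast

lemma finite_layered_vertices: "finite (layered_vertices m)"
  by (simp add: layered_vertices_def)

lemma card_layered_vertices: "card (layered_vertices m) = 5 * m"
  by (simp add: layered_vertices_def card_cartesian_product card_layer)

lemma finite_simple_graph_layered: "finite_simple_graph (layered_vertices m) (layered_edges m r)"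
proof -
  have "{x, y} \<in> [layered_vertices m]\<^bsup>2\<^esup>"
    if "x \<in> layered_vertices m" "y \<in> layered_vertices m" "linked r x y" for x y
    using that linked_irrefl[of r x] by (cases "x = y") (auto simp: nsets_def)
  then show ?thesis
    unfolding finite_simple_graph_def layered_edges_def using finite_layered_vertices by blast
qed

text \<open>The layer steps around a triangle are 1 or 2 in absolute value and sum to 0 modulo 5, so
  up to sign and order they are 1, 1, -2 or 1, 2, 2. The first would need an arc together with its
  reverse, the second a loop.\<close>

lemma linked_no_triangle:
  assumes r: "good_tournament m r"
    and V: "x \<in> layered_vertices m" "y \<in> layered_vertices m" "z \<in> layered_vertices m"
    and xy: "linked r x y" and yz: "linked r y z"
  shows "\<not> linked r x z"
proof
  assume xz: "linked r x z"
  have irrefl: "\<not> r a a" if "a < m" for a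
    using r that by (simp add: good_tournament_def)
  have "r a b = (\<not> r b a)" if "a < m" "b < m" "a \<noteq> b" for a b
    using r that unfolding good_tournament_def by blast
  then have asym: "\<not> (r a b \<and> r b a)" if "a < m" "b < m" for a b
    using that irrefl by metis
  obtain i a where [simp]: "x = (i, a)" by (cases x)
  obtain j b where [simp]: "y = (j, b)" by (cases y)
  obtain k c where [simp]: "z = (k, c)" by (cases z)
  have "a < m" "b < m" "c < m" using V by (auto simp: layered_vertices_def)
  note facts = irrefl[OF this(1)] irrefl[OF this(2)] irrefl[OF this(3)]
    asym[OF this(1,2)] asym[OF this(1,3)] asym[OF this(2,3)]
  show False
    using xy yz xz facts
    by (cases i; cases j; cases k) (auto simp: linked_def)
qed

lemma linked_diameter:
  assumes r: "good_tournament m r"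
    and V: "x \<in> layered_vertices m" "y \<in> layered_vertices m" "x \<noteq> y" "\<not> linked r x y"
  shows "\<exists>z\<in>layered_vertices m. linked r x z \<and> linked r y z"
proof -
  have pair: "\<exists>c<m. r a c \<and> r b c \<or> r c a \<and> r c b" if "a < m" "b < m" "a \<noteq> b" for a b
    using r that unfolding good_tournament_def by blast
  have path: "\<exists>c<m. r a c \<and> r c b" if "a < m" "b < m" "r a b" for a b
    using r that unfolding good_tournament_def by blast
  have anti: "r a b \<or> r b a" if "a < m" "b < m" "a \<noteq> b" for a b
    using r that unfolding good_tournament_def by blast
  \<comment> \<open>Layers two apart: an arc from \<open>a\<close> to \<open>b\<close> is replaced
    by a path of length two through the middle layer; otherwise an arc from \<open>b\<close> to
    \<open>a\<close> is combined with a vertical edge.\<close>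
  have far: "\<exists>z\<in>layered_vertices m. linked r (i, a) z \<and> linked r (nxt (nxt i), b) z"
    if ab: "a < m" "b < m" "a \<noteq> b" for i a b
  proof (cases "r a b")
    case True
    then obtain c where "c < m" "r a c" "r c b" using path ab by blast
    then show ?thesis
      by (intro bexI[of _ "(nxt i, c)"]) (auto simp: linked_def layered_vertices_def)
  next
    case False
    then have "r b a" using anti that by blast
    then show ?thesis using that
      by (intro bexI[of _ "(nxt (nxt (nxt (nxt i))), b)"])
        (cases i; simp add: linked_def layered_vertices_def)+
  qed
  \<comment> \<open>Consecutive layers: two vertical edges within one column, or a vertical edge and
    an arc from \<open>b\<close> to \<open>a\<close>.\<close>
  have near: "\<exists>z\<in>layered_vertices m. linked r (i, a) z \<and> linked r (nxt i, b) z"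
    if "a < m" "b < m" "\<not> r a b" for i a b
  proof (cases "a = b")
    case True
    then show ?thesis using that
      by (intro bexI[of _ "(nxt (nxt (nxt i)), a)"])
        (cases i; simp add: linked_def layered_vertices_def)+
  next
    case False
    then have "r b a" using anti that by blast
    then show ?thesis using that
      by (intro bexI[of _ "(nxt (nxt i), a)"]) (auto simp: linked_def layered_vertices_def)
  qed
  obtain i a j b where [simp]: "x = (i, a)" "y = (j, b)" by (cases x; cases y)
  have ab: "a < m" "b < m" using V by (auto simp: layered_vertices_def)
  consider "j = i" | "j = nxt i" | "i = nxt j" | "j = nxt (nxt i)" | "i = nxt (nxt j)"
    by (cases i; cases j; simp)
  then show ?thesis
  proof cases
    case 1
    then have "a \<noteq> b" using V(3) by simp
    then obtain c where c: "c < m" "r a c \<and> r b c \<or> r c a \<and> r c b" using pair ab by blast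
    have prev: "nxt (nxt (nxt (nxt (nxt i)))) = i" by (cases i) auto
    show ?thesis
    proof (cases "r a c \<and> r b c")
      case True
      then show ?thesis using c(1) 1
        by (intro bexI[of _ "(nxt i, c)"]) (simp_all add: linked_def layered_vertices_def)
    next
      case False
      then have "r c a" "r c b" using c(2) by blast+
      then show ?thesis using c(1) 1 prev
        by (intro bexI[of _ "(nxt (nxt (nxt (nxt i))), c)"])
          (simp_all add: linked_def layered_vertices_def)
    qed
  next
    case 2
    then show ?thesis using near[OF ab] V(4) by (auto simp: linked_def)
  next
    case 3
    then show ?thesis using near[OF ab(2,1)] V(4) by (auto simp: linked_def)
  next
    case 4
    then have "a \<noteq> b" using V(4) by (auto simp: linked_def)
    then show ?thesis using far[OF ab] 4 by simp
  next
    case 5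
    then have "b \<noteq> a" using V(4) by (auto simp: linked_def)
    then show ?thesis using far[OF ab(2,1)] 5 by auto
  qed
qed

lemma card_unlinked_le:
  assumes r: "good_tournament m r" and I: "I \<subseteq> layered_vertices m"
    and unlinked: "\<And>x y. x \<in> I \<Longrightarrow> y \<in> I \<Longrightarrow> \<not> linked r x y"
  shows "card I \<le> m + 1"
proof -
  let ?L = "\<lambda>a. {i. (i, a) \<in> I}"
  have "layering m r ?L"
    unfolding layering_def using unlinked by (fastforce simp: linked_def)
  then have "(\<Sum>a<m. card (?L a)) \<le> m + 1"
    using r unfolding good_tournament_def by blast
  moreover have "I = prod.swap ` (SIGMA a:{..<m}. ?L a)"
    using I by (force simp: layered_vertices_def image_iff)
  then have "card I = card (SIGMA a:{..<m}. ?L a)"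
    by (metis card_image inj_swap)
  ultimately show ?thesis by simp
qed

text \<open>The witness takes layers \<open>i\<close> and \<open>i + 1\<close> in columns
  \<open>a\<close> and \<open>b\<close>, and layer \<open>i + 3\<close> in all others. The latter is
  adjacent to neither of the former by arcs, and vertical edges stay within a column. The size is
  \<open>4 + (m - 2)\<close>.\<close>

lemma critical_layer_edge:
  assumes r: "good_tournament m r" and ab: "a < m" "b < m" "r a b"
  shows "\<exists>I\<subseteq>layered_vertices m. card I = m + 2 \<and>
    (\<forall>x\<in>I. \<forall>y\<in>I. linked r x y \<longrightarrow> {x, y} = {(i, a), (nxt i, b)})"
proof -
  have irrefl: "\<not> r a a" "\<not> r b b"
    using r ab by (auto simp: good_tournament_def)
  have neq: "a \<noteq> b" using irrefl ab(3) by blast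
  have "\<not> r b a" using r ab neq unfolding good_tournament_def by blast
  let ?j = "nxt (nxt (nxt i))"
  let ?I = "{(i, a), (i, b), (nxt i, a), (nxt i, b)} \<union> {?j} \<times> ({..<m} - {a, b})"
  have "card ?I = card {(i, a), (i, b), (nxt i, a), (nxt i, b)} + card ({?j} \<times> ({..<m} - {a, b}))"
    by (intro card_Un_disjoint) auto
  also have "\<dots> = m + 2"
  proof -
    have "card ({..<m} - {a, b}) = m - 2" using ab neq by (subst card_Diff_subset) auto
    moreover have "2 \<le> m" using ab neq by linarith
    moreover have "card {(i, a), (i, b), (nxt i, a), (nxt i, b)} = 4" using neq nxt_neq(1)[of i] by simp
    ultimately show ?thesis by (simp add: card_cartesian_product)
  qed
  finally have "card ?I = m + 2" .
  moreover have "?I \<subseteq> layered_vertices m" using ab by (auto simp: layered_vertices_def)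
  moreover have "\<forall>x\<in>?I. \<forall>y\<in>?I. linked r x y \<longrightarrow> {x, y} = {(i, a), (nxt i, b)}"
    using irrefl neq \<open>\<not> r b a\<close> by (cases i; auto simp: linked_def)
  ultimately show ?thesis by blast
qed

text \<open>The witness takes three consecutive layers in column \<open>a\<close>. Every other
  column \<open>b\<close> contributes layer \<open>i\<close> if \<open>a\<close> beats
  \<open>b\<close> and layer \<open>i + 2\<close> otherwise, precisely so as to avoid the middle
  vertex \<open>(i + 1, a)\<close>. The size is \<open>3 + (m - 1)\<close>.\<close>

lemma critical_vertical_edge:
  assumes r: "good_tournament m r" and a: "a < m"
  shows "\<exists>I\<subseteq>layered_vertices m. card I = m + 2 \<and>
    (\<forall>x\<in>I. \<forall>y\<in>I. linked r x y \<longrightarrow> {x, y} = {(i, a), (nxt (nxt i), a)})"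
proof -
  define Out where "Out = {b. b < m \<and> b \<noteq> a \<and> r a b}"
  define In where "In = {b. b < m \<and> b \<noteq> a \<and> \<not> r a b}"
  have irrefl: "\<not> r a a" using r a by (simp add: good_tournament_def)
  have anti: "r b a \<longleftrightarrow> \<not> r a b" if "b < m" "b \<noteq> a" for b
    using r a that unfolding good_tournament_def by metis
  let ?j = "nxt (nxt i)"
  let ?I = "{(i, a), (nxt i, a), (?j, a)} \<union> ({i} \<times> Out \<union> {?j} \<times> In)"
  have fin: "finite Out" "finite In" by (auto simp: Out_def In_def)
  have "card ?I = card {(i, a), (nxt i, a), (?j, a)} + card ({i} \<times> Out \<union> {?j} \<times> In)"
    using fin by (intro card_Un_disjoint) (auto simp: Out_def In_def)
  moreover have "card {(i, a), (nxt i, a), (?j, a)} = 3"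
    using nxt_neq[of i] nxt_neq[of "nxt i"] by simp
  moreover have "card ({i} \<times> Out \<union> {?j} \<times> In) = card Out + card In"
    using fin nxt_neq[of i] by (subst card_Un_disjoint) (auto simp: card_cartesian_product)
  moreover have "card Out + card In = m - 1"
  proof -
    have "card Out + card In = card (Out \<union> In)"
      using fin by (intro card_Un_disjoint[symmetric]) (auto simp: Out_def In_def)
    also have "Out \<union> In = {..<m} - {a}" by (auto simp: Out_def In_def)
    finally show ?thesis using a by simp
  qed
  ultimately have "card ?I = m + 2" using a by linarith
  moreover have "?I \<subseteq> layered_vertices m" using a by (auto simp: layered_vertices_def Out_def In_def)
  moreover have "\<forall>x\<in>?I. \<forall>y\<in>?I. linked r x y \<longrightarrow> {x, y} = {(i, a), (?j, a)}"
    using irrefl anti by (cases i; auto simp: linked_def Out_def In_def)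
  ultimately show ?thesis by blast
qed

lemma layered_edge_critical:
  assumes r: "good_tournament m r"
    and V: "x \<in> layered_vertices m" "y \<in> layered_vertices m" and xy: "linked r x y"
  shows "\<exists>I\<subseteq>layered_vertices m. card I = m + 2 \<and>
    (\<forall>u\<in>I. \<forall>v\<in>I. linked r u v \<longrightarrow> {u, v} = {x, y})"
proof -
  obtain i a j b where [simp]: "x = (i, a)" "y = (j, b)" by (cases x; cases y)
  have ab: "a < m" "b < m" using V by (auto simp: layered_vertices_def)
  consider "j = nxt i" "r a b" | "i = nxt j" "r b a" | "a = b" "j = nxt (nxt i)" | "a = b" "i = nxt (nxt j)"
    using xy by (auto simp: linked_def)
  then show ?thesis
  proof cases
    case 1
    then show ?thesis using critical_layer_edge[OF r ab] by simp
  next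
    case 2
    then show ?thesis using critical_layer_edge[OF r ab(2,1)] by (simp add: insert_commute)
  next
    case 3
    then show ?thesis using critical_vertical_edge[OF r ab(1)] by simp
  next
    case 4
    then show ?thesis using critical_vertical_edge[OF r ab(1)] by (simp add: insert_commute)
  qed
qed

lemma doubly_saturated_layered:
  assumes r: "good_tournament m r"
  shows "doubly_saturated 3 (m + 2) (layered_vertices m) (layered_edges m r)"
proof -
  let ?V = "layered_vertices m" and ?E = "layered_edges m r"
  have "R_good 3 (m + 2) ?V ?E"
  proof (rule R_good_3I)
    fix x y z assume "{x, y} \<in> ?E" "{y, z} \<in> ?E" "{x, z} \<in> ?E"
    then show False using linked_no_triangle[OF r] unfolding edge_iff by blast
  next
    fix I assume I: "I \<subseteq> ?V" "indep I ?E"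
    have "\<not> linked r x y" if "x \<in> I" "y \<in> I" for x y
    proof
      assume "linked r x y"
      moreover from this have "x \<noteq> y" using linked_irrefl by metis
      ultimately show False using I that unfolding indep_def by (metis edge_iff subsetD)
    qed
    then have "card I \<le> m + 1" using card_unlinked_le[OF r I(1)] by blast
    then show "card I \<noteq> m + 2" by simp
  qed
  moreover have "\<not> R_good 3 (m + 2) ?V (insert e ?E)" if e: "e \<in> [?V]\<^bsup>2\<^esup> - ?E" for e
  proof -
    obtain x y where xy: "e = {x, y}" "x \<noteq> y" "x \<in> ?V" "y \<in> ?V"
      using e by (auto simp: nsets_def card_2_iff)
    then have "\<not> linked r x y" using e by (auto simp: edge_iff)
    then obtain z where z: "z \<in> ?V" "linked r x z" "linked r y z"
      using linked_diameter[OF r] xy by blast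
    then have "x \<noteq> z" "y \<noteq> z" using linked_irrefl by metis+
    moreover have "{x, z} \<in> ?E" "{y, z} \<in> ?E" using z xy edge_iff by metis+
    ultimately have "clique {x, y, z} (insert e ?E)"
      unfolding clique_def xy(1) by (auto simp: insert_commute)
    moreover have "card {x, y, z} = 3" using xy(2) \<open>x \<noteq> z\<close> \<open>y \<noteq> z\<close> by simp
    moreover have "{x, y, z} \<subseteq> ?V" using xy z by blast
    ultimately show ?thesis unfolding R_good_def by blast
  qed
  moreover have "\<not> R_good 3 (m + 2) ?V (?E - {e})" if e: "e \<in> ?E" for e
  proof -
    obtain x y where xy: "e = {x, y}" "x \<in> ?V" "y \<in> ?V" "linked r x y"
      using e unfolding layered_edges_def by blast
    then obtain I where I: "I \<subseteq> ?V" "card I = m + 2"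
      "\<forall>u\<in>I. \<forall>v\<in>I. linked r u v \<longrightarrow> {u, v} = {x, y}"
      using layered_edge_critical[OF r xy(2-4)] by metis
    then have "indep I (?E - {e})"
      unfolding indep_def xy(1) by (auto simp: edge_iff)
    then show ?thesis using I unfolding R_good_def by blast
  qed
  ultimately show ?thesis unfolding doubly_saturated_def by blast
qed

section \<open>Transport of a graph to natural-number vertices\<close>

lemma clique_indep_image:
  assumes "inj_on f V" "E \<subseteq> Pow V" "K \<subseteq> V"
  shows "clique (f ` K) ((`) f ` E) \<longleftrightarrow> clique K E"
    and "indep (f ` K) ((`) f ` E) \<longleftrightarrow> indep K E"
proof -
  have "f ` {u, v} \<in> (`) f ` E \<longleftrightarrow> {u, v} \<in> E" if "u \<in> K" "v \<in> K" for u v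
    using inj_on_image_mem_iff[OF inj_on_image_Pow[OF assms(1)], of "{u, v}" E] that assms by blast
  moreover have "f u = f v \<longleftrightarrow> u = v" if "u \<in> K" "v \<in> K" for u v
    using that assms(1,3) by (meson inj_on_eq_iff subsetD)
  ultimately show "clique (f ` K) ((`) f ` E) \<longleftrightarrow> clique K E"
    "indep (f ` K) ((`) f ` E) \<longleftrightarrow> indep K E"
    unfolding clique_def indep_def by simp_all
qed

lemma R_good_image:
  assumes "inj_on f V" "E \<subseteq> Pow V"
  shows "R_good s t (f ` V) ((`) f ` E) \<longleftrightarrow> R_good s t V E"
proof -
  have image: "(\<exists>K\<subseteq>f ` V. card K = n \<and> P K) \<longleftrightarrow> (\<exists>K\<subseteq>V. card K = n \<and> P (f ` K))" for n P
    using assms(1) by (metis (no_types, lifting) card_image image_mono inj_on_subset subset_image_iff)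
  show ?thesis
    unfolding R_good_def image using clique_indep_image[OF assms] by (simp cong: conj_cong)
qed

text \<open>\<open>DS\<close> ranges over vertex sets of natural numbers, so the graph is copied
  along an injection; edges and missing edges correspond because images are injective on
  \<open>Pow V\<close>.\<close>

lemma DS_le:
  assumes graph: "finite_simple_graph V E" and V2: "2 \<le> card V" and ds: "doubly_saturated s t V E"
  shows "DS s t \<le> enat (card V)"
proof -
  have fin: "finite V" and E: "E \<subseteq> [V]\<^bsup>2\<^esup>" using graph by (auto simp: finite_simple_graph_def)
  obtain f :: "'a \<Rightarrow> nat" where f: "inj_on f V"
    using finite_imp_inj_to_nat_seg[OF fin] by metis
  have E': "E \<subseteq> Pow V" using E by (auto simp: nsets_def)
  let ?V = "f ` V" and ?E = "(`) f ` E"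
  have inj: "inj_on ((`) f) (Pow V)" using f by (rule inj_on_image_Pow)
  have image_pairs: "[?V]\<^bsup>2\<^esup> = (`) f ` [V]\<^bsup>2\<^esup>"
    using bij_betw_nsets[of f V ?V 2] f by (simp add: bij_betw_def)
  have card: "card ?V = card V" using f by (rule card_image)
  have "doubly_saturated s t ?V ?E"
    unfolding doubly_saturated_def
  proof (intro conjI ballI)
    show "R_good s t ?V ?E"
      using ds R_good_image[OF f E'] by (simp add: doubly_saturated_def)
  next
    fix e' assume e': "e' \<in> [?V]\<^bsup>2\<^esup> - ?E"
    then obtain e where e: "e' = f ` e" "e \<in> [V]\<^bsup>2\<^esup>"
      unfolding image_pairs by (elim DiffE imageE)
    moreover from this have "e \<notin> E" using e' by blast
    ultimately have e: "e' = f ` e" "e \<in> [V]\<^bsup>2\<^esup>" "e \<notin> E" by blast+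
    then have "insert e E \<subseteq> Pow V" using E' by (auto simp: nsets_def)
    then show "\<not> R_good s t ?V (insert e' ?E)"
      using R_good_image[OF f, of "insert e E"] ds e by (simp add: doubly_saturated_def)
  next
    fix e' assume "e' \<in> ?E"
    then obtain e where e: "e' = f ` e" "e \<in> E" by blast
    have "?E - {e'} = (`) f ` (E - {e})"
      using inj_on_image_set_diff[OF inj, of E "{e}"] e E' by auto
    moreover have "E - {e} \<subseteq> Pow V" using E' by blast
    ultimately show "\<not> R_good s t ?V (?E - {e'})"
      using R_good_image[OF f, of "E - {e}"] ds e(2) by (simp add: doubly_saturated_def)
  qed
  moreover have "finite_simple_graph ?V ?E"
    unfolding finite_simple_graph_def image_pairs using fin E by blast
  ultimately show ?thesis
    unfolding DS_def using V2 card by (intro Inf_lower) (metis (mono_tags, lifting) mem_Collect_eq)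
qed

subsection \<open>Substituting a tournament for a vertex\<close>

text \<open>Vertex \<open>n\<close>, the last one of \<open>r\<close>, is replaced by a copy of \<open>s\<close> on \<open>n, n + 1, \<dots>\<close>.\<close>

definition graft :: "nat \<Rightarrow> (nat \<Rightarrow> nat \<Rightarrow> bool) \<Rightarrow> (nat \<Rightarrow> nat \<Rightarrow> bool) \<Rightarrow> nat \<Rightarrow> nat \<Rightarrow> bool" where
  "graft n r s a b = (if n \<le> a \<and> n \<le> b then s (a - n) (b - n) else r (min a n) (min b n))"

lemma sum_split_last:
  fixes f :: "nat \<Rightarrow> nat"
  shows "sum f {..<n + p} = sum f {..<n} + (\<Sum>j<p. f (n + j))"
  by (induction p) auto

text \<open>The map \<open>?q\<close> collapses the copy of \<open>s\<close> to \<open>n\<close>.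
  Common neighbours and paths come from \<open>s\<close> inside the copy and from \<open>r\<close>
  elsewhere. For the independence bound, the layers used in the copy are collapsed into one column
  of \<open>r\<close>, trading columns outside against columns inside.\<close>

lemma good_tournament_graft:
  assumes r: "good_tournament (Suc n) r" and s: "good_tournament p s" and "0 < p"
  shows "good_tournament (n + p) (graft n r s)"
proof -
  let ?g = "graft n r s" and ?q = "\<lambda>a. min a n"
  have q: "?q a < Suc n" for a by simp
  have inner: "?g a b = s (a - n) (b - n)" if "n \<le> a" "n \<le> b" for a b
    using that by (simp add: graft_def)
  have outer: "?g a b = r (?q a) (?q b)" if "?q a \<noteq> ?q b" for a b
    using that by (auto simp: graft_def)
  have eq_q: "?q a = ?q b \<longleftrightarrow> a = b \<or> n \<le> a \<and> n \<le> b" for a b by (auto simp: min_def)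
  have r_irrefl: "\<not> r a a" if "a < Suc n" for a
    using r that by (simp add: good_tournament_def)
  have lift: "?g a c = r (?q a) c" "?g c a = r c (?q a)" if "c \<noteq> ?q a" "c < Suc n" for a c
    using that by (auto simp: graft_def min_def)
  have r_pair: "\<exists>c<Suc n. r a c \<and> r b c \<or> r c a \<and> r c b"
    if "a < Suc n" "b < Suc n" "a \<noteq> b" for a b
    using r that unfolding good_tournament_def by blast
  have s_pair: "\<exists>c<p. s a c \<and> s b c \<or> s c a \<and> s c b" if "a < p" "b < p" "a \<noteq> b" for a b
    using s that unfolding good_tournament_def by blast
  have r_path: "\<exists>c<Suc n. r a c \<and> r c b" if "a < Suc n" "b < Suc n" "r a b" for a b
    using r that unfolding good_tournament_def by blast
  have s_path: "\<exists>c<p. s a c \<and> s c b" if "a < p" "b < p" "s a b" for a b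
    using s that unfolding good_tournament_def by blast
  have r_anti: "r a b = (\<not> r b a)" if "a < Suc n" "b < Suc n" "a \<noteq> b" for a b
    using r that unfolding good_tournament_def by blast
  have s_anti: "s a b = (\<not> s b a)" if "a < p" "b < p" "a \<noteq> b" for a b
    using s that unfolding good_tournament_def by blast
  show ?thesis
    unfolding good_tournament_def
  proof (intro conjI allI impI)
    fix a assume "a < n + p"
    then show "\<not> ?g a a"
      using r_irrefl[of a] r_irrefl[of n] s by (auto simp: graft_def good_tournament_def min_def)
  next
    fix a b assume ab: "a < n + p" "b < n + p" "a \<noteq> b"
    show "?g a b = (\<not> ?g b a)"
    proof (cases "?q a = ?q b")
      case True
      then have "n \<le> a" "n \<le> b" using ab eq_q by auto
      moreover from this have "a - n < p" "b - n < p" "a - n \<noteq> b - n" using ab by linarith+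
      ultimately show ?thesis using s_anti[of "a - n" "b - n"] inner by metis
    next
      case False
      then show ?thesis using r_anti[OF q q] outer by metis
    qed
  next
    fix a b assume ab: "a < n + p" "b < n + p" "a \<noteq> b"
    show "\<exists>c<n + p. ?g a c \<and> ?g b c \<or> ?g c a \<and> ?g c b"
    proof (cases "?q a = ?q b")
      case True
      then have le: "n \<le> a" "n \<le> b" using ab eq_q by auto
      then have "a - n < p" "b - n < p" "a - n \<noteq> b - n" using ab by linarith+
      then obtain c where c: "c < p"
        "s (a - n) c \<and> s (b - n) c \<or> s c (a - n) \<and> s c (b - n)"
        using s_pair by blast
      then show ?thesis using le by (intro exI[of _ "n + c"]) (simp add: inner)
    next
      case False
      then obtain c where c: "c < Suc n"
        "r (?q a) c \<and> r (?q b) c \<or> r c (?q a) \<and> r c (?q b)"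
        using r_pair[OF q q] by blast
      then have "c \<noteq> ?q a" "c \<noteq> ?q b" using r_irrefl by metis+
      \<comment> \<open>If \<open>c = n\<close>, the first vertex of the copy represents it;
        \<open>0 < p\<close> ensures that it exists.\<close>
      then show ?thesis
        using c \<open>0 < p\<close> by (intro exI[of _ c]) (simp add: lift)
    qed
  next
    fix a b assume ab: "a < n + p" "b < n + p" "?g a b"
    show "\<exists>c<n + p. ?g a c \<and> ?g c b"
    proof (cases "?q a = ?q b")
      case True
      then have le: "n \<le> a" "n \<le> b" using ab(3) r_irrefl[OF q, of b] by (auto simp: graft_def split: if_splits)
      then have "a - n < p" "b - n < p" "s (a - n) (b - n)" using ab inner by auto
      then obtain c where c: "c < p" "s (a - n) c \<and> s c (b - n)"
        using s_path by blast
      then show ?thesis using le by (intro exI[of _ "n + c"]) (simp add: inner)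
    next
      case False
      then have "r (?q a) (?q b)" using ab outer by blast
      then obtain c where c: "c < Suc n" "r (?q a) c \<and> r c (?q b)"
        using r_path[OF q q] by blast
      then have "c \<noteq> ?q a" "c \<noteq> ?q b" using r_irrefl by metis+
      then show ?thesis
        using c \<open>0 < p\<close> by (intro exI[of _ c]) (simp add: lift)
    qed
  next
    fix L assume L: "layering (n + p) ?g L"
    have L1: "nxt (nxt i) \<notin> L a" if "a < n + p" "i \<in> L a" for a i
      using L that unfolding layering_def by blast
    have L2: "nxt i \<notin> L b" if "a < n + p" "b < n + p" "?g a b" "i \<in> L a" for a b i
      using L that unfolding layering_def by blast
    define U where "U = (\<Union>j<p. L (n + j))"
    have "layering p s (\<lambda>j. L (n + j))"
      unfolding layering_def
    proof (intro conjI allI impI ballI)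
      fix a i assume "a < p" "i \<in> L (n + a)"
      then show "nxt (nxt i) \<notin> L (n + a)" using L1[of "n + a"] by simp
    next
      fix a b i assume "a < p" "b < p" "s a b" "i \<in> L (n + a)"
      then show "nxt i \<notin> L (n + b)" using L2[of "n + a" "n + b"] by (simp add: inner)
    qed
    then have inner_sum: "(\<Sum>j<p. card (L (n + j))) \<le> p + 1"
      using s unfolding good_tournament_def by blast
    \<comment> \<open>Vertices of the copy have the same arcs to the outside as \<open>n\<close> in
      \<open>r\<close>, so any admissible \<open>W\<close> drawn from the union \<open>U\<close> may
      serve as column \<open>n\<close> of a layering of \<open>r\<close>.\<close>
    have outer_sum: "(\<Sum>a<n. card (L a)) + card W \<le> n + 2"
      if W: "W \<subseteq> U" "\<And>i. i \<in> W \<Longrightarrow> nxt (nxt i) \<notin> W" for W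
    proof -
      have source: "\<exists>a'<n + p. ?q a' = a \<and> i \<in> L a'"
        if ai: "a < Suc n" "i \<in> (L(n := W)) a" for a i
      proof (cases "a = n")
        case True
        then obtain j where "j < p" "i \<in> L (n + j)" using ai(2) W(1) by (auto simp: U_def)
        then show ?thesis using True by (intro exI[of _ "n + j"]) auto
      next
        case False
        then show ?thesis using ai by (intro exI[of _ a]) auto
      qed
      have "layering (Suc n) r (L(n := W))"
        unfolding layering_def
      proof (intro conjI allI impI ballI)
        fix a i assume "a < Suc n" "i \<in> (L(n := W)) a"
        then show "nxt (nxt i) \<notin> (L(n := W)) a"
          using L1[of a] W(2) by (auto split: if_splits)
      next
        fix a b i assume ab: "a < Suc n" "b < Suc n" "r a b" and i: "i \<in> (L(n := W)) a"
        then have neq: "a \<noteq> b" using r_irrefl by blast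
        obtain a' where a': "a' < n + p" "?q a' = a" "i \<in> L a'"
          using source[OF ab(1) i] by blast
        show "nxt i \<notin> (L(n := W)) b"
        proof
          assume "nxt i \<in> (L(n := W)) b"
          then obtain b' where b': "b' < n + p" "?q b' = b" "nxt i \<in> L b'"
            using source[OF ab(2)] by blast
          then show False using L2[OF a'(1) b'(1) _ a'(3)] outer[of a' b'] a'(2) neq ab(3) by simp
        qed
      qed
      then have "(\<Sum>a<Suc n. card ((L(n := W)) a)) \<le> Suc n + 1"
        using r unfolding good_tournament_def by blast
      moreover have "(\<Sum>a<n. card ((L(n := W)) a)) = (\<Sum>a<n. card (L a))"
        by (intro sum.cong) auto
      ultimately show ?thesis by simp
    qed
    have "(\<Sum>a<n. card (L a)) + (\<Sum>j<p. card (L (n + j))) \<le> n + p + 1"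
    \<comment> \<open>Two consecutive layers in \<open>U\<close> leave at most \<open>n\<close>
      outside and \<open>p + 1\<close> inside. Without them each inner column has at most one layer:
      at most \<open>p\<close> inside and \<open>n + 1\<close> outside. An empty \<open>U\<close>
      leaves at most \<open>n + 2\<close>, which is enough as \<open>0 < p\<close>.\<close>
    proof (cases "\<exists>i. {i, nxt i} \<subseteq> U")
      case True
      then obtain i where i: "{i, nxt i} \<subseteq> U" by blast
      have "nxt (nxt j) \<notin> {i, nxt i}" if "j \<in> {i, nxt i}" for j
        using that by (cases i) auto
      then show ?thesis using outer_sum[OF i] inner_sum by (simp add: nxt_neq)
    next
      case False
      show ?thesis
      proof (cases "U = {}")
        case True
        then have "L (n + j) = {}" if "j < p" for j using that unfolding U_def by blast
        then have "(\<Sum>j<p. card (L (n + j))) = 0" by simp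
        then show ?thesis using outer_sum[of "{}"] \<open>0 < p\<close> by simp
      next
        case nonempty: False
        then obtain i where i: "{i} \<subseteq> U" by blast
        have "card (L (n + j)) \<le> 1" if "j < p" for j
        proof -
          have sub: "L (n + j) \<subseteq> U" using that unfolding U_def by blast
          show ?thesis
            by (rule layer_set_cases[OF L1[of "n + j"]]) (use that False sub in auto)
        qed
        then have "(\<Sum>j<p. card (L (n + j))) \<le> (\<Sum>j<p. 1)" by (intro sum_mono) auto
        then show ?thesis using outer_sum[OF i] nxt_neq by fastforce
      qed
    qed
    then show "(\<Sum>a<n + p. card (L a)) \<le> n + p + 1" by (simp add: sum_split_last)
  qed
qed

subsection \<open>Tournaments on seven and nine vertices\<close>

text \<open>The three outcomes of \<open>layer_set_cases\<close> for a column, as data for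
  evaluation.\<close>

datatype choice = Absent | Single layer | Double layer

fun layers_of :: "choice \<Rightarrow> layer set" where
  "layers_of Absent = {}"
| "layers_of (Single i) = {i}"
| "layers_of (Double i) = {i, nxt i}"

fun weight :: "choice \<Rightarrow> nat" where
  "weight Absent = 0"
| "weight (Single _) = Suc 0"
| "weight (Double _) = Suc (Suc 0)"

fun clash :: "choice \<Rightarrow> choice \<Rightarrow> bool" where
  "clash (Single i) (Single j) \<longleftrightarrow> nxt i = j"
| "clash (Single i) (Double j) \<longleftrightarrow> i = j \<or> nxt i = j"
| "clash (Double i) (Single j) \<longleftrightarrow> nxt i = j \<or> nxt (nxt i) = j"
| "clash (Double i) (Double j) \<longleftrightarrow> i = j \<or> nxt i = j \<or> nxt (nxt i) = j"
| "clash _ _ \<longleftrightarrow> False"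

text \<open>Between distinct vertices of a tournament, absence of an arc means the reverse arc, so
  one Boolean fixes the direction in which \<open>clash\<close> is tested.\<close>

definition compatible :: "bool \<Rightarrow> choice \<Rightarrow> choice \<Rightarrow> bool" where
  "compatible b p q \<longleftrightarrow> (if b then \<not> clash p q else \<not> clash q p)"

fun head_weight :: "choice list \<Rightarrow> nat" where
  "head_weight [] = 0"
| "head_weight (p # ps) = weight p"

text \<open>The bound is the sum of the first weights, so it is only valid for domains sorted by
  decreasing weight.\<close>

fun shortfall :: "nat \<Rightarrow> choice list list \<Rightarrow> nat" where
  "shortfall n [] = n"
| "shortfall n (d # ds) = shortfall (n - head_weight d) ds"

text \<open>Branch and bound for a choice of total weight at least \<open>n\<close>. The first row records the
  orientation of the arcs from the first vertex to the later ones.\<close>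

fun search :: "nat \<Rightarrow> bool list list \<Rightarrow> choice list list \<Rightarrow> bool" where
  "search n (row # rows) (d # ds) \<longleftrightarrow>
     (if shortfall n (d # ds) = 0
      then list_ex (\<lambda>p. search (n - weight p) rows (map2 (\<lambda>b. filter (compatible b p)) row ds)) d
      else False)"
| "search n _ _ \<longleftrightarrow> n = 0"

fun upper_rows :: "('a \<Rightarrow> 'a \<Rightarrow> bool) \<Rightarrow> 'a list \<Rightarrow> bool list list" where
  "upper_rows r [] = []"
| "upper_rows r (v # vs) = map (r v) vs # upper_rows r vs"

text \<open>Listed by decreasing weight, as \<open>shortfall\<close> requires.\<close>

definition all_choices :: "choice list" where
  "all_choices = map Double [Z0, Z1, Z2, Z3, Z4] @ map Single [Z0, Z1, Z2, Z3, Z4] @ [Absent]"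

lemma weight_layers_of: "weight p = card (layers_of p)"
  by (cases p) (auto simp: nxt_neq)

lemma clash_iff: "clash p q \<longleftrightarrow> (\<exists>i\<in>layers_of p. nxt i \<in> layers_of q)"
proof -
  have inj: "nxt i = nxt j \<longleftrightarrow> i = j" for i j by (cases i; cases j; simp)
  show ?thesis by (cases p; cases q) (auto simp: inj)
qed

definition heaviest_first :: "choice list \<Rightarrow> bool" where
  "heaviest_first d \<longleftrightarrow> sorted_wrt (\<lambda>p q. weight q \<le> weight p) d"

lemma shortfall_eq_0:
  assumes "list_all2 (\<lambda>p d. p \<in> set d \<and> heaviest_first d) ps ds" and "n \<le> sum_list (map weight ps)"
  shows "shortfall n ds = 0"
  using assms
proof (induction arbitrary: n rule: list_all2_induct)
  case (Cons p ps d ds)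
  then have "weight p \<le> head_weight d" by (cases d) (auto simp: heaviest_first_def)
  then show ?case using Cons by simp
qed simp

text \<open>The branch \<open>f v\<close> discards only choices incompatible with
  \<open>f v\<close>, hence no later \<open>f u\<close>; filtering keeps domains sorted, so the
  pruning bound stays valid along this branch.\<close>

lemma search_complete:
  assumes "sorted_wrt (\<lambda>u v. compatible (r u v) (f u) (f v)) vs"
    and "list_all2 (\<lambda>v d. f v \<in> set d \<and> heaviest_first d) vs ds"
    and "n \<le> sum_list (map (weight \<circ> f) vs)"
  shows "search n (upper_rows r vs) ds"
  using assms
proof (induction vs arbitrary: n ds)
  case (Cons v vs)
  then obtain d ds' where ds: "ds = d # ds'" "f v \<in> set d"
    and tl: "list_all2 (\<lambda>v d. f v \<in> set d \<and> heaviest_first d) vs ds'"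
    by (auto simp: list_all2_Cons1)
  have "list_all2 (\<lambda>p d. p \<in> set d \<and> heaviest_first d) (map f (v # vs)) ds"
    using Cons.prems(2) unfolding list_all2_map1 .
  then have "shortfall n ds = 0"
    by (rule shortfall_eq_0) (use Cons.prems(3) in \<open>simp add: o_def\<close>)
  moreover have "search (n - weight (f v)) (upper_rows r vs)
      (map2 (\<lambda>b. filter (compatible b (f v))) (map (r v) vs) ds')"
  proof (rule Cons.IH)
    show "list_all2 (\<lambda>u d. f u \<in> set d \<and> heaviest_first d) vs
        (map2 (\<lambda>b. filter (compatible b (f v))) (map (r v) vs) ds')"
      using tl Cons.prems(1)
      by (auto simp: list_all2_conv_all_nth heaviest_first_def sorted_wrt_filter)
  qed (use Cons.prems in auto)
  ultimately show ?case using ds by (auto simp: list_ex_iff)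
qed simp

text \<open>A layering of size at least \<open>m + 2\<close> would be a branch of the failed
  search.\<close>

lemma sum_card_layering_le:
  assumes irrefl: "\<forall>a<m. \<not> r a a" and anti: "\<forall>a<m. \<forall>b<m. a \<noteq> b \<longrightarrow> r a b = (\<not> r b a)"
    and search: "\<not> search (m + 2) (upper_rows r [0..<m]) (replicate m all_choices)"
    and L: "layering m r L"
  shows "(\<Sum>a<m. card (L a)) \<le> m + 1"
proof (rule ccontr)
  assume large: "\<not> ?thesis"
  have "\<exists>p. L a = layers_of p" if "a < m" for a
  proof -
    have "nxt (nxt i) \<notin> L a" if "i \<in> L a" for i
      using L that \<open>a < m\<close> unfolding layering_def by blast
    then show ?thesis
      by (rule layer_set_cases) (metis layers_of.simps)+
  qed
  then obtain f where f: "L a = layers_of (f a)" if "a < m" for a by metis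
  have "sorted_wrt (\<lambda>u v. compatible (r u v) (f u) (f v)) [0..<m]"
  proof -
    have "compatible (r u v) (f u) (f v)" if "u < v" "v < m" for u v
    proof -
      have "r u v \<or> r v u" using anti that by (metis less_trans nat_neq_iff)
      then show ?thesis
        using L that f[of u] f[of v] unfolding layering_def compatible_def clash_iff
        by (metis less_trans)
    qed
    then show ?thesis by (auto simp: sorted_wrt_iff_nth_less)
  qed
  moreover have "p \<in> set all_choices" for p
  proof -
    have "i \<in> set [Z0, Z1, Z2, Z3, Z4]" for i by (cases i) auto
    then show ?thesis unfolding all_choices_def by (cases p) auto
  qed
  moreover have "heaviest_first all_choices"
    by (simp add: all_choices_def heaviest_first_def)
  ultimately have "search (m + 2) (upper_rows r [0..<m]) (replicate m all_choices)"
  proof (intro search_complete)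
    have "(\<Sum>a<m. card (L a)) = sum_list (map (weight \<circ> f) [0..<m])"
      by (simp add: weight_layers_of f interv_sum_list_conv_sum_set_nat atLeast0LessThan)
    then show "m + 2 \<le> sum_list (map (weight \<circ> f) [0..<m])" using large by linarith
  qed (auto simp: list_all2_conv_all_nth)
  then show False using search by simp
qed

lemma good_tournamentI:
  assumes "\<forall>a<m. \<not> r a a" and "\<forall>a<m. \<forall>b<m. a \<noteq> b \<longrightarrow> r a b = (\<not> r b a)"
    and "\<forall>a<m. \<forall>b<m. a \<noteq> b \<longrightarrow> (\<exists>c<m. r a c \<and> r b c \<or> r c a \<and> r c b)"
    and "\<forall>a<m. \<forall>b<m. r a b \<longrightarrow> (\<exists>c<m. r a c \<and> r c b)"
    and "\<not> search (m + 2) (upper_rows r [0..<m]) (replicate m all_choices)"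
  shows "good_tournament m r"
  using assms sum_card_layering_le[OF assms(1,2,5)] unfolding good_tournament_def by blast

text \<open>The Paley tournament: 1, 2, 4 are the nonzero squares modulo 7. The added 7 prevents
  truncated subtraction for \<open>a < 7\<close>.\<close>

definition tournament7 :: "nat \<Rightarrow> nat \<Rightarrow> bool" where
  "tournament7 a b \<longleftrightarrow> (b + 7 - a) mod 7 \<in> {1, 2, 4}"

text \<open>Found by random search; no circulant tournament on 9 vertices is suitable.\<close>

definition tournament9 :: "nat \<Rightarrow> nat \<Rightarrow> bool" where
  "tournament9 a b \<longleftrightarrow> b \<in> set
     ([[1, 4, 5], [2, 3, 5], [0, 3, 4], [0, 5, 6, 7], [1, 3, 7, 8], [2, 4, 6, 8],
       [0, 1, 2, 4, 7], [0, 1, 2, 5, 8], [0, 1, 2, 3, 6]] ! a)"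

lemma bounded_7_iff:
  "(\<forall>a<7. P a) \<longleftrightarrow> P 0 \<and> P 1 \<and> P 2 \<and> P 3 \<and> P 4 \<and> P 5 \<and> P (6::nat)"
  "(\<exists>a<7. P a) \<longleftrightarrow> P 0 \<or> P 1 \<or> P 2 \<or> P 3 \<or> P 4 \<or> P 5 \<or> P (6::nat)"
  by (simp add: numeral_eq_Suc All_less_Suc Ex_less_Suc; blast)+

lemma bounded_9_iff:
  "(\<forall>a<9. P a) \<longleftrightarrow> P 0 \<and> P 1 \<and> P 2 \<and> P 3 \<and> P 4 \<and> P 5 \<and> P 6 \<and> P 7 \<and> P (8::nat)"
  "(\<exists>a<9. P a) \<longleftrightarrow> P 0 \<or> P 1 \<or> P 2 \<or> P 3 \<or> P 4 \<or> P 5 \<or> P 6 \<or> P 7 \<or> P (8::nat)"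
  by (simp add: numeral_eq_Suc All_less_Suc Ex_less_Suc; blast)+

lemma search_tournament7:
  "\<not> search (7 + 2) (upper_rows tournament7 [0..<7]) (replicate 7 all_choices)"
  by code_simp

lemma search_tournament9:
  "\<not> search (9 + 2) (upper_rows tournament9 [0..<9]) (replicate 9 all_choices)"
  by code_simp

lemma good_tournament7: "good_tournament 7 tournament7"
  by (rule good_tournamentI[OF _ _ _ _ search_tournament7])
    (simp_all add: bounded_7_iff tournament7_def)

lemma good_tournament9: "good_tournament 9 tournament9"
  by (rule good_tournamentI[OF _ _ _ _ search_tournament9])
    (simp_all add: bounded_9_iff tournament9_def)

text \<open>Grafting \<open>tournament7\<close> adds 6 vertices, so one order in each odd residue
  class modulo 6 suffices: 13 = 6 + 7, 15 = 8 + 7 and 17 = 8 + 9, the last from two copies of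
  \<open>tournament9\<close>.\<close>

lemma good_tournament_exists:
  assumes "odd m" "13 \<le> m"
  shows "\<exists>r. good_tournament m r"
  using assms
proof (induction m rule: less_induct)
  case (less m)
  have step: "\<exists>r. good_tournament (n + 7) r" if "\<exists>r. good_tournament (Suc n) r" for n
    using that good_tournament_graft[OF _ good_tournament7] by auto
  consider "m = 13" | "m = 15" | "m = 17" | "19 \<le> m"
    using less.prems by atomize_elim presburger
  then show ?case
  proof cases
    case 1
    then show ?thesis using step[of 6] good_tournament7 by auto
  next
    case 2
    then show ?thesis using step[of 8] good_tournament9 by auto
  next
    case 3
    then show ?thesis
      using good_tournament_graft[of 8 tournament9 9 tournament9] good_tournament9 by auto
  next
    case 4
    then have "\<exists>r. good_tournament (m - 6) r"
      using less.IH[of "m - 6"] less.prems(1) by simp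
    moreover have "m - 6 = Suc (m - 7)" using 4 by linarith
    ultimately have "\<exists>r. good_tournament (Suc (m - 7)) r" by metis
    then show ?thesis using step[of "m - 7"] 4 by simp
  qed
qed

theorem corollary7p1:
  fixes t :: nat
  assumes "odd t" and "t \<ge> 17"
  shows "enat (2 * t - 1) \<le> DS 3 t \<and> DS 3 t \<le> enat (5 * t - 10)"
proof
  show "enat (2 * t - 1) \<le> DS 3 t"
    unfolding DS_def
  proof (rule Inf_greatest)
    fix x assume "x \<in> {enat (card V) | (V :: nat set) E.
      finite_simple_graph V E \<and> 2 \<le> card V \<and> doubly_saturated 3 t V E}"
    then obtain V :: "nat set" and E where x: "x = enat (card V)"
      and VE: "finite_simple_graph V E" "2 \<le> card V" "doubly_saturated 3 t V E"
      by blast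
    have "2 * t - 1 \<le> card V"
      by (rule doubly_saturated_lower_bound[OF VE]) (use assms(2) in simp)
    then show "enat (2 * t - 1) \<le> x" using x by simp
  qed
next
  \<comment> \<open>Independent sets of size \<open>m + 2\<close> are the forbidden ones, and five
    layers of \<open>t - 2\<close> vertices give order \<open>5 * t - 10\<close>.\<close>
  define m where "m = t - 2"
  have "odd m" "13 \<le> m" and t: "m + 2 = t" using assms by (auto simp: m_def)
  then obtain r where r: "good_tournament m r" using good_tournament_exists by blast
  have "DS 3 t \<le> enat (card (layered_vertices m))"
    using finite_simple_graph_layered doubly_saturated_layered[OF r] \<open>13 \<le> m\<close> t
    by (intro DS_le) (auto simp: card_layered_vertices)
  moreover have "5 * m = 5 * t - 10" using t by linarith
  ultimately show "DS 3 t \<le> enat (5 * t - 10)" by (simp add: card_layered_vertices)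
qed

end
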